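(* For every $\varepsilon,\varepsilon'>0$, there exist a non-empty finite graph $G=(V,E)$, a vertex $o\in V$, a subset $B\subseteq V$, a parameter $p\in[0,1]$, and two families of increasing events $(C_b)_{b\in B}$ and $(E_b)_{b\in B}$ such that $\mathbb P\bigl[\bigcup_{b\in B}C_b\bigr]>0$ and $$\mathbb P\Bigl[\bigcup_{b\in B}(C_b\cap E_b)\ \Big|\ \bigcup_{b\in B}C_b\Bigr]\le\varepsilon',$$ while $\mathbb P[E_b]\ge1-\varepsilon$ for every $b\in B$.
   Context: $\mathbb P$ is the probability measure of a probability space carrying a random percolation configuration $\pi=(\pi_e)_{e\in E}\in\{0,1\}^E$ whose coordinates are independent Bernoulli random variables with parameter $p$ (edge $e$ is open if $\pi_e=1$, closed if $\pi_e=0$). Graphs are undirected loopless multigraphs. An event $A$ is increasing (with respect to the percolation configuration) if $\omega\mapsto\mathbb P[A\mid\pi=\omega]$ is nondecreasing on $\{0,1\}^E$ for the coordinatewise partial order; if $A$ is $\sigma(\pi)$-measurable this is the usual notion of an increasing event. *)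

theory Defs
  imports "HOL-Probability.Probability"
begin

text \<open>
  Edges carry their own identity and are sent by \<open>ends\<close> to an unordered pair of distinct
  vertices, so parallel edges are allowed and loops are not.
\<close>

locale finite_multigraph =
  fixes V :: "'v set" and E :: "'e set" and ends :: "'e \<Rightarrow> 'v set"
  assumes finite_V: "finite V"
    and finite_E: "finite E"
    and ends_subset: "e \<in> E \<Longrightarrow> ends e \<subseteq> V"
    and card_ends: "e \<in> E \<Longrightarrow> card (ends e) = 2"

text \<open>
  A probability space \<open>M\<close>, possibly with more randomness than the configuration itself, carrying
  independent Bernoulli variables indexed by the edges. States are of type \<^typ>\<open>bool\<close>, with
  \<^const>\<open>True\<close> for open (1) and \<^const>\<open>False\<close> for closed (0), so that the order on
  \<^typ>\<open>bool\<close> is the one on \<open>{0, 1}\<close>.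
\<close>

locale percolation = prob_space M
  for M :: "'m measure" and E :: "'e set" and p :: real and \<pi> :: "'e \<Rightarrow> 'm \<Rightarrow> bool" +
  assumes p_range: "p \<in> {0..1}"
    and indep: "indep_vars (\<lambda>_. count_space UNIV) \<pi> E"
    and bernoulli: "e \<in> E \<Longrightarrow> distr M (count_space UNIV) (\<pi> e) = measure_pmf (bernoulli_pmf p)"

text \<open>
  \<open>increasing_event M E \<pi> A\<close>: the map \<open>\<omega> \<mapsto> P[A | \<pi> = \<omega>]\<close> is nondecreasing. Configurations are
  total functions of which only the values on \<open>E\<close> are used. The conditional probability is
  meaningful only for configurations of positive probability, hence the two positivity premises
  (they matter only for \<open>p = 0\<close> and \<open>p = 1\<close> if \<open>E\<close> is finite).
\<close>

definition config_is :: "'e set \<Rightarrow> ('e \<Rightarrow> 'm \<Rightarrow> bool) \<Rightarrow> ('e \<Rightarrow> bool) \<Rightarrow> 'm \<Rightarrow> bool" where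
  "config_is E \<pi> \<omega> x \<longleftrightarrow> (\<forall>e\<in>E. \<pi> e x = \<omega> e)"

definition increasing_event ::
  "'m measure \<Rightarrow> 'e set \<Rightarrow> ('e \<Rightarrow> 'm \<Rightarrow> bool) \<Rightarrow> 'm set \<Rightarrow> bool" where
  "increasing_event M E \<pi> A \<longleftrightarrow>
     A \<in> sets M \<and>
     (\<forall>\<omega> \<omega>'. (\<forall>e\<in>E. \<omega> e \<le> \<omega>' e) \<longrightarrow>
        \<P>(x in M. config_is E \<pi> \<omega> x) > 0 \<longrightarrow> \<P>(x in M. config_is E \<pi> \<omega>' x) > 0 \<longrightarrow>
        \<P>(x in M. x \<in> A \<bar> config_is E \<pi> \<omega> x) \<le> \<P>(x in M. x \<in> A \<bar> config_is E \<pi> \<omega>' x))"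

text \<open>Percolation spaces exist for every finite edge set and every \<open>p \<in> [0, 1]\<close>.\<close>

lemma percolation_Pi_pmf:
  assumes "finite E" and "p \<in> {0..1}"
  shows "percolation (measure_pmf (Pi_pmf E False (\<lambda>_. bernoulli_pmf p))) E p (\<lambda>e \<omega>. \<omega> e)"
proof
  show "prob_space.indep_vars (measure_pmf (Pi_pmf E False (\<lambda>_. bernoulli_pmf p)))
          (\<lambda>_. count_space UNIV) (\<lambda>e \<omega>. \<omega> e) E"
    by (rule indep_vars_Pi_pmf[OF assms(1)])
  show "distr (measure_pmf (Pi_pmf E False (\<lambda>_. bernoulli_pmf p))) (count_space UNIV) (\<lambda>\<omega>. \<omega> e)
          = measure_pmf (bernoulli_pmf p)" if "e \<in> E" for e
    using Pi_pmf_component[OF assms(1), of e False "\<lambda>_. bernoulli_pmf p"] that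
    by (simp flip: map_pmf_rep_eq)
qed (rule assms(2))

end

theory Submission
  imports Defs
begin

text \<open>
  By the Harris inequality each single \<open>b\<close> satisfies \<open>P(C\<^sub>b \<inter> E\<^sub>b) \<ge> P(C\<^sub>b) P(E\<^sub>b)\<close>, so only a union over
  many \<open>b\<close> can behave badly: the events \<open>C\<^sub>b \<inter> E\<^sub>b\<close> should overlap heavily, while the events
  \<open>C\<^sub>b - E\<^sub>b\<close> should be disjoint, so that the union consists mostly of the latter even though each
  of them is a small part of its \<open>C\<^sub>b\<close>.

  Such a family comes from the sets \<open>D\<close> of \<open>m\<close> edges among \<open>n\<close> edges in percolation with parameter
  \<open>1/2\<close>. Let \<open>C\<^sub>D\<close> say that all closed edges lie in \<open>D\<close>, and \<open>E\<^sub>D\<close> that some edge of \<open>D\<close> is open.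
  Both are increasing, and \<open>P(E\<^sub>D) = 1 - 2\<^sup>-\<^sup>m\<close>. On \<open>C\<^sub>D\<close>, the event \<open>E\<^sub>D\<close> fails exactly if the closed
  edges are those of \<open>D\<close>. Hence the union of the \<open>C\<^sub>D\<close> is the event of at most \<open>m\<close> closed edges, the
  union of the \<open>C\<^sub>D \<inter> E\<^sub>D\<close> is the event of fewer than \<open>m\<close> closed edges, and the conditional probability
  is at most the quotient of \<open>\<Sum>j<m. n choose j\<close> by \<open>n choose m\<close>. This tends to 0 if \<open>m\<close> is fixed and
  \<open>n\<close> grows. For the graph one can take \<open>n\<close> parallel edges, with enough further vertices to serve as
  names of the sets \<open>D\<close>.
\<close>

section \<open>The set of closed edges\<close>

definition closed_edges :: "'e set \<Rightarrow> ('e \<Rightarrow> 'm \<Rightarrow> bool) \<Rightarrow> 'm \<Rightarrow> 'e set" where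
  "closed_edges E \<pi> x = {e\<in>E. \<not> \<pi> e x}"

lemma closed_edges_eq_iff_config_is:
  assumes "T \<subseteq> E"
  shows "closed_edges E \<pi> x = T \<longleftrightarrow> config_is E \<pi> (\<lambda>e. e \<notin> T) x"
  using assms unfolding closed_edges_def config_is_def by blast

context percolation
begin

lemma measurable_state: "e \<in> E \<Longrightarrow> \<pi> e \<in> measurable M (count_space UNIV)"
  using indep unfolding indep_vars_def by simp

lemma prob_state:
  assumes "e \<in> E"
  shows "prob (\<pi> e -` {s} \<inter> space M) = pmf (bernoulli_pmf p) s"
proof -
  have "prob (\<pi> e -` {s} \<inter> space M) = measure (distr M (count_space UNIV) (\<pi> e)) {s}"
    using measurable_state[OF assms] by (simp add: measure_distr)
  then show ?thesis
    by (simp add: bernoulli[OF assms] pmf.rep_eq)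
qed

lemma prob_cylinder:
  assumes "finite J" "J \<subseteq> E"
  shows "\<P>(x in M. \<forall>e\<in>J. \<pi> e x = \<omega> e) = (\<Prod>e\<in>J. pmf (bernoulli_pmf p) (\<omega> e))"
proof (cases "J = {}")
  case True
  then show ?thesis by (simp add: prob_space)
next
  case False
  have "{x \<in> space M. \<forall>e\<in>J. \<pi> e x = \<omega> e} = (\<Inter>e\<in>J. \<pi> e -` {\<omega> e} \<inter> space M)"
    using False by auto
  also have "prob \<dots> = (\<Prod>e\<in>J. prob (\<pi> e -` {\<omega> e} \<inter> space M))"
    using False assms by (intro indep_varsD[OF indep]) auto
  also have "\<dots> = (\<Prod>e\<in>J. pmf (bernoulli_pmf p) (\<omega> e))"
    using assms by (intro prod.cong refl prob_state) auto
  finally show ?thesis .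
qed

lemma prob_fair_cylinder:
  assumes "p = 1 / 2" "finite J" "J \<subseteq> E"
  shows "\<P>(x in M. \<forall>e\<in>J. \<pi> e x = \<omega> e) = 1 / 2 ^ card J"
proof -
  have "pmf (bernoulli_pmf p) s = 1 / 2" for s
    unfolding assms(1) by (cases s) auto
  then show ?thesis
    unfolding prob_cylinder[OF assms(2,3)] by (simp only: prod_constant power_one_over)
qed

lemma sets_config_is:
  assumes "finite E"
  shows "{x \<in> space M. config_is E \<pi> \<omega> x} \<in> sets M"
  unfolding config_is_def
proof (rule sets.sets_Collect_finite_All[OF _ assms])
  fix e assume "e \<in> E"
  from measurable_sets[OF measurable_state[OF this], of "{\<omega> e}"]
  show "{x \<in> space M. \<pi> e x = \<omega> e} \<in> sets M"
    by (simp add: vimage_def Int_def conj_commute)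
qed

lemma sets_closed_edges:
  assumes "finite E"
  shows "{x \<in> space M. Q (closed_edges E \<pi> x)} \<in> sets M"
proof -
  have "{x \<in> space M. Q (closed_edges E \<pi> x)} =
      (\<Union>T\<in>{T \<in> Pow E. Q T}. {x \<in> space M. config_is E \<pi> (\<lambda>e. e \<notin> T) x})"
    by (auto simp flip: closed_edges_eq_iff_config_is) (auto simp: closed_edges_def)
  also have "\<dots> \<in> sets M"
    using assms by (intro sets.finite_UN sets_config_is) auto
  finally show ?thesis .
qed

lemma prob_closed_edges:
  assumes "finite E" "p = 1 / 2"
  shows "\<P>(x in M. Q (closed_edges E \<pi> x)) = real (card {T \<in> Pow E. Q T}) / 2 ^ card E"
proof -
  let ?A = "\<lambda>T. {x \<in> space M. closed_edges E \<pi> x = T}"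
  have "{x \<in> space M. Q (closed_edges E \<pi> x)} = (\<Union>T\<in>{T \<in> Pow E. Q T}. ?A T)"
    by (auto simp: closed_edges_def)
  also have "prob \<dots> = (\<Sum>T\<in>{T \<in> Pow E. Q T}. prob (?A T))"
    using assms sets_closed_edges
    by (intro finite_measure_finite_Union) (auto simp: disjoint_family_on_def)
  also have "\<dots> = (\<Sum>T\<in>{T \<in> Pow E. Q T}. 1 / 2 ^ card E)"
    using prob_fair_cylinder[OF assms(2,1) order_refl]
    by (intro sum.cong refl) (simp add: closed_edges_eq_iff_config_is config_is_def)
  finally show ?thesis by simp
qed

text \<open>
  Conditioning on a full configuration determines the set of closed edges, so the conditional
  probability is the indicator of \<open>Q\<close> at that set, and opening more edges shrinks that set.
\<close>

lemma increasing_event_closed_edges: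
  assumes "finite E"
    and antitone: "\<And>S T. \<lbrakk>S \<subseteq> T; T \<subseteq> E; Q T\<rbrakk> \<Longrightarrow> Q S"
  shows "increasing_event M E \<pi> {x \<in> space M. Q (closed_edges E \<pi> x)}"
proof -
  let ?A = "{x \<in> space M. Q (closed_edges E \<pi> x)}"
  let ?P = "\<lambda>\<omega>. \<P>(x in M. config_is E \<pi> \<omega> x)"
  have determined: "\<P>(x in M. x \<in> ?A \<bar> config_is E \<pi> \<omega> x) = (if Q {e\<in>E. \<not> \<omega> e} then 1 else 0)"
    if "?P \<omega> > 0" for \<omega>
  proof -
    have "closed_edges E \<pi> x = {e\<in>E. \<not> \<omega> e}" if "config_is E \<pi> \<omega> x" for x
      using that unfolding config_is_def closed_edges_def by auto
    then have "{x \<in> space M. x \<in> ?A \<and> config_is E \<pi> \<omega> x} =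
        (if Q {e\<in>E. \<not> \<omega> e} then {x \<in> space M. config_is E \<pi> \<omega> x} else {})"
      by auto
    with that show ?thesis by (simp add: cond_prob_def)
  qed
  have mono: "Q {e\<in>E. \<not> \<omega>' e}" if "\<forall>e\<in>E. \<omega> e \<le> \<omega>' e" "Q {e\<in>E. \<not> \<omega> e}" for \<omega> \<omega>'
    by (rule antitone[OF _ _ that(2)]) (use that(1) in auto)
  show ?thesis
    unfolding increasing_event_def
  proof (intro conjI allI impI)
    show "?A \<in> sets M"
      by (rule sets_closed_edges[OF assms(1)])
    fix \<omega> \<omega>' assume le: "\<forall>e\<in>E. \<omega> e \<le> \<omega>' e" and "?P \<omega> > 0" "?P \<omega>' > 0"
    then show "\<P>(x in M. x \<in> ?A \<bar> config_is E \<pi> \<omega> x) \<le> \<P>(x in M. x \<in> ?A \<bar> config_is E \<pi> \<omega>' x)"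
      using mono[OF le] by (simp only: determined) simp
  qed
qed

end

section \<open>Counting small sets\<close>

lemma card_subsets_card_less:
  assumes "finite A"
  shows "card {S \<in> Pow A. card S < m} = (\<Sum>j<m. card A choose j)"
proof -
  have "{S \<in> Pow A. card S < m} = (\<Union>j<m. {S. S \<subseteq> A \<and> card S = j})"
    by auto
  also have "card \<dots> = (\<Sum>j<m. card {S. S \<subseteq> A \<and> card S = j})"
    using assms by (intro card_UN_disjoint) auto
  finally show ?thesis using n_subsets[OF assms] by simp
qed

text \<open>
  For \<open>j < m\<close>, \<open>n choose j\<close> is at most \<open>n\<^sup>j\<close> and hence at most \<open>n\<^sup>m / n\<close>, while \<open>n choose m\<close> is at least \<open>(n/m)\<^sup>m\<close>.
\<close>

lemma sum_lower_binomials_le: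
  assumes "m \<le> n"
  shows "real n * (\<Sum>j<m. real (n choose j)) \<le> real m ^ Suc m * real (n choose m)"
proof (cases "m = 0")
  case False
  have le: "real n * real (n choose j) \<le> real m ^ m * real (n choose m)" if "j < m" for j
  proof -
    have "real n * real (n choose j) \<le> real n * real n ^ j"
      using binomial_le_pow[of j n] that assms
      by (intro mult_left_mono) (simp_all flip: of_nat_power)
    also have "\<dots> \<le> real n ^ m"
      using that assms by (simp flip: power_Suc add: power_increasing)
    also have "\<dots> = real m ^ m * (real n / real m) ^ m"
      using False by (simp add: power_divide)
    also have "\<dots> \<le> real m ^ m * real (n choose m)"
      using binomial_ge_n_over_k_pow_k[OF assms, where 'a = real] by (intro mult_left_mono) auto
    finally show ?thesis .
  qed
  have "real n * (\<Sum>j<m. real (n choose j)) \<le> (\<Sum>j<m. real m ^ m * real (n choose m))"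
    unfolding sum_distrib_left using le by (intro sum_mono) simp
  then show ?thesis by (simp add: mult.assoc)
qed simp

section \<open>Unions of increasing events indexed by sets of edges\<close>

lemma exists_superset_card_eq_iff:
  assumes "finite E" "T \<subseteq> E" "m \<le> card E"
  shows "(\<exists>D\<subseteq>E. card D = m \<and> T \<subseteq> D) \<longleftrightarrow> card T \<le> m"
proof
  show "card T \<le> m" if "\<exists>D\<subseteq>E. card D = m \<and> T \<subseteq> D"
    using that assms(1) by (meson card_mono finite_subset)
  show "\<exists>D\<subseteq>E. card D = m \<and> T \<subseteq> D" if "card T \<le> m"
    using exists_subset_between[OF that assms(3,2,1)] by blast
qed

text \<open>
  Since \<open>D\<close> has exactly \<open>m\<close> elements, a proper subset of it has fewer; conversely a set with fewer
  than \<open>m\<close> elements is a proper subset of any \<open>m\<close>-set that contains it.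
\<close>

lemma exists_proper_superset_card_eq_iff:
  assumes "finite E" "T \<subseteq> E" "m \<le> card E"
  shows "(\<exists>D\<subseteq>E. card D = m \<and> T \<subset> D) \<longleftrightarrow> card T < m"
proof
  show "card T < m" if "\<exists>D\<subseteq>E. card D = m \<and> T \<subset> D"
    using that assms(1) by (meson psubset_card_mono finite_subset)
  show "\<exists>D\<subseteq>E. card D = m \<and> T \<subset> D" if "card T < m"
  proof -
    obtain D where D: "D \<subseteq> E" "card D = m" "T \<subseteq> D"
      using exists_superset_card_eq_iff[OF assms] \<open>card T < m\<close> by auto
    moreover have "T \<noteq> D"
      using D(2) \<open>card T < m\<close> by auto
    ultimately show ?thesis by blast
  qed
qed

context percolation
begin

lemma prob_some_edge_open:
  assumes "finite E" "p = 1 / 2" "D \<subseteq> E"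
  shows "\<P>(x in M. \<not> D \<subseteq> closed_edges E \<pi> x) = 1 - 1 / 2 ^ card D"
proof -
  have "{x \<in> space M. D \<subseteq> closed_edges E \<pi> x} = {x \<in> space M. \<forall>e\<in>D. \<pi> e x = False}"
    using assms(3) by (auto simp: closed_edges_def)
  then have "\<P>(x in M. D \<subseteq> closed_edges E \<pi> x) = 1 / 2 ^ card D"
    using prob_fair_cylinder[OF assms(2) finite_subset[OF assms(3,1)] assms(3), of "\<lambda>_. False"] by simp
  then show ?thesis
    using prob_neg[OF sets_closed_edges[OF assms(1)], of "\<lambda>T. D \<subseteq> T"] by simp
qed

lemma cond_prob_fewer_closed_edges_le:
  assumes "finite E" "p = 1 / 2" "m \<le> card E" "0 < card E"
  shows "\<P>(x in M. card (closed_edges E \<pi> x) \<le> m) > 0"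
    and "\<P>(x in M. card (closed_edges E \<pi> x) < m \<bar> card (closed_edges E \<pi> x) \<le> m)
           \<le> real m ^ Suc m / real (card E)"
proof -
  let ?n = "card E"
  have "card {T. T \<subseteq> E \<and> card T = m} \<le> card {T \<in> Pow E. card T \<le> m}"
    using assms(1) by (intro card_mono) auto
  then have many: "real (?n choose m) / 2 ^ ?n \<le> \<P>(x in M. card (closed_edges E \<pi> x) \<le> m)"
    using assms(1,2) n_subsets[OF assms(1)]
    by (simp add: prob_closed_edges[where Q = "\<lambda>T. card T \<le> m"] divide_right_mono)
  have pos: "0 < real (?n choose m) / 2 ^ ?n"
    using assms(3) by simp
  from pos many show "\<P>(x in M. card (closed_edges E \<pi> x) \<le> m) > 0"
    by linarith
  have few: "\<P>(x in M. card (closed_edges E \<pi> x) < m) = (\<Sum>j<m. real (?n choose j)) / 2 ^ ?n"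
    unfolding prob_closed_edges[OF assms(1,2), where Q = "\<lambda>T. card T < m"]
      card_subsets_card_less[OF assms(1)] by simp
  have "\<P>(x in M. card (closed_edges E \<pi> x) < m \<bar> card (closed_edges E \<pi> x) \<le> m)
      = \<P>(x in M. card (closed_edges E \<pi> x) < m) / \<P>(x in M. card (closed_edges E \<pi> x) \<le> m)"
    unfolding cond_prob_def by (rule arg_cong2[where f = "(/)"]) (auto intro!: arg_cong[where f = prob])
  also have "\<dots> \<le> (\<Sum>j<m. real (?n choose j)) / 2 ^ ?n / (real (?n choose m) / 2 ^ ?n)"
    unfolding few by (intro frac_le many pos order_refl divide_nonneg_nonneg sum_nonneg) simp_all
  also have "\<dots> = (\<Sum>j<m. real (?n choose j)) / real (?n choose m)"
    by simp
  also have "\<dots> \<le> real m ^ Suc m / real ?n"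
    using sum_lower_binomials_le[OF assms(3)] assms(3,4) by (simp add: field_simps)
  finally show "\<P>(x in M. card (closed_edges E \<pi> x) < m \<bar> card (closed_edges E \<pi> x) \<le> m)
      \<le> real m ^ Suc m / real ?n" .
qed

end

section \<open>The family with small conditional probability\<close>

theorem proposition2p5:
  fixes \<epsilon> \<epsilon>' :: real
  assumes "\<epsilon> > 0" and "\<epsilon>' > 0"
  shows "\<exists>(V :: nat set) (E :: nat set) (ends :: nat \<Rightarrow> nat set) (v0 :: nat) (B :: nat set) (p :: real).
           finite_multigraph V E ends \<and> V \<noteq> {} \<and> v0 \<in> V \<and> B \<subseteq> V \<and> p \<in> {0..1} \<and>
           (\<forall>(M :: 'm measure) (\<pi> :: nat \<Rightarrow> 'm \<Rightarrow> bool). percolation M E p \<pi> \<longrightarrow>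
              (\<exists>(C_ev :: nat \<Rightarrow> 'm set) (E_ev :: nat \<Rightarrow> 'm set).
                 (\<forall>b\<in>B. increasing_event M E \<pi> (C_ev b)) \<and>
                 (\<forall>b\<in>B. increasing_event M E \<pi> (E_ev b)) \<and>
                 \<P>(x in M. x \<in> (\<Union>b\<in>B. C_ev b)) > 0 \<and>
                 \<P>(x in M. x \<in> (\<Union>b\<in>B. C_ev b \<inter> E_ev b) \<bar> x \<in> (\<Union>b\<in>B. C_ev b)) \<le> \<epsilon>' \<and>
                 (\<forall>b\<in>B. \<P>(x in M. x \<in> E_ev b) \<ge> 1 - \<epsilon>)))"
proof -
  obtain m where m: "1 / 2 ^ m < \<epsilon>"
    using real_arch_pow_inv[OF assms(1), of "1 / 2"] by (auto simp: power_divide)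
  obtain k where k: "real m ^ Suc m / \<epsilon>' < real k"
    using reals_Archimedean2 by blast
  define n where "n = Suc (k + m)"
  define E where "E = {..<n}"
  \<comment> \<open>A vertex \<open>b\<close> of \<open>B\<close> is the code of the \<open>m\<close>-set \<open>set_decode b\<close> of edges; all edges join 0 and 1.\<close>
  define B where "B = set_encode ` {D. D \<subseteq> E \<and> card D = m}"
  have finE: "finite E" and cardE: "card E = n" and mE: "m \<le> card E"
    by (simp_all add: E_def n_def)
  have "finite B"
    using finE by (simp add: B_def)
  then have graph: "finite_multigraph ({0, 1} \<union> B) E (\<lambda>_. {0, 1})"
    using finE by unfold_locales auto
  have decode: "set_decode ` B = {D. D \<subseteq> E \<and> card D = m}"
  proof -
    have "set_decode (set_encode D) = D" if "D \<subseteq> E" for D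
      using that finE by (simp add: finite_subset)
    then show ?thesis
      unfolding B_def by (auto simp: image_image)
  qed
  have "real m ^ Suc m < \<epsilon>' * real k"
    using k assms(2) by (simp add: field_simps)
  also have "\<dots> \<le> \<epsilon>' * real n"
    using assms(2) by (simp add: n_def)
  finally have small: "real m ^ Suc m / real n \<le> \<epsilon>'"
    by (simp add: n_def field_simps)
  have events: "\<exists>(C_ev :: nat \<Rightarrow> 'm set) (E_ev :: nat \<Rightarrow> 'm set).
      (\<forall>b\<in>B. increasing_event M E \<pi> (C_ev b)) \<and>
      (\<forall>b\<in>B. increasing_event M E \<pi> (E_ev b)) \<and>
      \<P>(x in M. x \<in> (\<Union>b\<in>B. C_ev b)) > 0 \<and>
      \<P>(x in M. x \<in> (\<Union>b\<in>B. C_ev b \<inter> E_ev b) \<bar> x \<in> (\<Union>b\<in>B. C_ev b)) \<le> \<epsilon>' \<and>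
      (\<forall>b\<in>B. \<P>(x in M. x \<in> E_ev b) \<ge> 1 - \<epsilon>)"
    if "percolation M E (1 / 2) \<pi>" for M :: "'m measure" and \<pi> :: "nat \<Rightarrow> 'm \<Rightarrow> bool"
  proof -
    interpret percolation M E "1 / 2" \<pi> by (rule that)
    let ?Z = "closed_edges E \<pi>"
    define C_ev where "C_ev b = {x \<in> space M. ?Z x \<subseteq> set_decode b}" for b
    define E_ev where "E_ev b = {x \<in> space M. \<not> set_decode b \<subseteq> ?Z x}" for b
    have Z: "?Z x \<subseteq> E" for x
      by (auto simp: closed_edges_def)
    have UC: "x \<in> (\<Union>b\<in>B. C_ev b) \<longleftrightarrow> card (?Z x) \<le> m" if "x \<in> space M" for x
    proof -
      have "x \<in> (\<Union>b\<in>B. C_ev b) \<longleftrightarrow> (\<exists>D\<in>set_decode ` B. ?Z x \<subseteq> D)"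
        using that by (auto simp: C_ev_def)
      also have "\<dots> \<longleftrightarrow> (\<exists>D\<subseteq>E. card D = m \<and> ?Z x \<subseteq> D)"
        unfolding decode by auto
      also have "\<dots> \<longleftrightarrow> card (?Z x) \<le> m"
        by (rule exists_superset_card_eq_iff[OF finE Z mE])
      finally show ?thesis .
    qed
    have UCE: "x \<in> (\<Union>b\<in>B. C_ev b \<inter> E_ev b) \<longleftrightarrow> card (?Z x) < m" if "x \<in> space M" for x
    proof -
      have "x \<in> (\<Union>b\<in>B. C_ev b \<inter> E_ev b) \<longleftrightarrow> (\<exists>D\<in>set_decode ` B. ?Z x \<subset> D)"
        using that by (auto simp: C_ev_def E_ev_def)
      also have "\<dots> \<longleftrightarrow> (\<exists>D\<subseteq>E. card D = m \<and> ?Z x \<subset> D)"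
        unfolding decode by auto
      also have "\<dots> \<longleftrightarrow> card (?Z x) < m"
        by (rule exists_proper_superset_card_eq_iff[OF finE Z mE])
      finally show ?thesis .
    qed
    have "increasing_event M E \<pi> (C_ev b)" "increasing_event M E \<pi> (E_ev b)" for b
      unfolding C_ev_def E_ev_def by (intro increasing_event_closed_edges[OF finE]; blast)+
    moreover have "\<P>(x in M. x \<in> (\<Union>b\<in>B. C_ev b)) = \<P>(x in M. card (?Z x) \<le> m)"
      by (simp only: UC cong: conj_cong)
    moreover have "\<P>(x in M. x \<in> (\<Union>b\<in>B. C_ev b \<inter> E_ev b) \<bar> x \<in> (\<Union>b\<in>B. C_ev b))
        = \<P>(x in M. card (?Z x) < m \<bar> card (?Z x) \<le> m)"
      by (simp only: cond_prob_def UC UCE cong: conj_cong)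
    moreover have "\<P>(x in M. x \<in> E_ev b) \<ge> 1 - \<epsilon>" if "b \<in> B" for b
    proof -
      have "set_decode b \<in> {D. D \<subseteq> E \<and> card D = m}"
        using that decode by blast
      then show ?thesis
        using prob_some_edge_open[OF finE refl, of "set_decode b"] m by (simp add: E_ev_def)
    qed
    moreover note cond_prob_fewer_closed_edges_le[OF finE refl mE]
    ultimately show ?thesis
      using small by (intro exI[of _ C_ev] exI[of _ E_ev]) (simp add: cardE n_def)
  qed
  show ?thesis
    by (rule exI[of _ "{0, 1} \<union> B"], rule exI[of _ E], rule exI[of _ "\<lambda>_. {0, 1}"],
        rule exI[of _ 0], rule exI[of _ B], rule exI[of _ "1 / 2"])
      (intro conjI allI impI graph events; simp add: subset_insertI2)
qed

end
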